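(* Let $k$ be a commutative ring with unit and let $(A,\mu,\alpha)$ be a hom-associative $k$-algebra which is not strongly degenerate and whose twisting map $\alpha$ is surjective. Then any formal hom-associative deformation $(A[[t]],\mu_t,\alpha_t)$ of $(A,\mu,\alpha)$ is obtained from a formal twisting with degree zero component $\alpha$ of an associative formal deformation of $(A,\alpha^{-1}\circ\mu)$. That is, there is an associative formal deformation $(A[[t]],\star_t)$ of the associative algebra $(A,\alpha^{-1}\circ\mu)$ such that $\alpha_t$ (whose degree zero component is $\alpha$) is a formal twisting of $A[[t]]$ with respect to $\star_t$ and $\mu_t(x,y)=\alpha_t(x\star_t y)$ for all $x,y\in A[[t]]$.
   Context: A hom-associative $k$-algebra $(A,\mu,\alpha)$ is a $k$-module $A$ with a $k$-bilinear operation $\mu:A\times A\to A$ and a $k$-linear map $\alpha:A\to A$ (the twisting map) such that $\mu(\alpha(x),\mu(y,z))=\mu(\mu(x,y),\alpha(z))$ for all $x,y,z\in A$. Neither a unit nor multiplicativity of $\alpha$ is assumed. $(A,\mu)$ is strongly degenerate if there exist $a\neq b$ in $A$ with $\mu(x,a)=\mu(x,b)$ and $\mu(a,x)=\mu(b,x)$ for all $x\in A$. If $(A,\mu,\alpha)$ is hom-associative, not strongly degenerate, and $\alpha$ is surjective, then $\alpha$ is bijective and $(A,\alpha^{-1}\circ\mu)$ is an associative algebra (the untwist of $A$), so the statement makes sense. $A[[t]]$ denotes the $k[[t]]$-module of formal power series $\sum_{i\ge 0}t^i a_i$ with $a_i\in A$. Maps of the form $\sum_{i\ge0}t^i\mu_i$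 (with $\mu_i:A\times A\to A$ $k$-bilinear) and $\sum_{i\ge0}t^i\alpha_i$ (with $\alpha_i:A\to A$ $k$-linear) are extended $k[[t]]$-(bi)linearly to $A[[t]]$ in the usual way: $(\sum_j t^ja_j,\sum_l t^lb_l)\mapsto\sum_{i,j,l}t^{i+j+l}\mu_i(a_j,b_l)$ and $\sum_j t^ja_j\mapsto\sum_{i,j}t^{i+j}\alpha_i(a_j)$. A formal (hom-associative) deformation of $(A,\mu,\alpha)$ is a triple $(A[[t]],\mu_t,\alpha_t)$ with $\mu_t=\sum_{i\ge0}t^i\mu_i$, $\mu_0=\mu$, and $\alpha_t=\sum_{i\ge0}t^i\alpha_i$, $\alpha_0=\alpha$, where the $\mu_i:A\times A\to A$ are $k$-bilinear, the $\alpha_i:A\to A$ are $k$-linear, and $\mu_t$ and $\alpha_t$ are extended to $A[[t]]$ by $\mu_t(\sum_j t^ja_j,\sum_l t^lb_l)=\sum_{i,j,l}t^{i+j+l}\mu_i(a_j,b_l)$ and $\alpha_t(\sum_j t^ja_j)=\sum_{i,j}t^{i+j}\alpha_i(a_j)$, such that $\mu_t(\alpha_t(x),\mu_t(y,z))=\mu_t(\mu_t(x,y),\alpha_t(z))$ for all $x,y,z\in A[[t]]$. An associative formal deformation of an associative $k$-algebra $(A,\nu)$ is a pair $(A[[t]],\star_t)$ where $\star_t=\sum_{i\ge0}t^i\nu_i$ with $\nu_i:A\times A\to A$ $k$-bilinear and $\nu_0=\nu$, extended $k[[t]]$-bilinearly to $A[[t]]$ by $(\sum_j t^ja_j)\star_t(\sum_l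 t^lb_l)=\sum_{i,j,l}t^{i+j+l}\nu_i(a_j,b_l)$, is an associative multiplication on $A[[t]]$. A formal twisting of $A[[t]]$ with respect to $\star_t$ is a $k[[t]]$-linear map $\alpha_t=\sum_{i\ge0}t^i\alpha_i:A[[t]]\to A[[t]]$, with $\alpha_i$ module endomorphisms of $A$, such that $\alpha_t(\alpha_t(x)\star_t\alpha_t(y\star_t z))=\alpha_t(\alpha_t(x\star_t y)\star_t\alpha_t(z))$ for all $x,y,z\in A[[t]]$; its degree zero component is $\alpha_0$. *)

theory Defs
  imports "HOL-Computational_Algebra.Formal_Power_Series"
begin

unbundle fps_syntax

definition k_linear :: "('k::comm_ring_1 \<Rightarrow> 'a::ab_group_add \<Rightarrow> 'a) \<Rightarrow> ('a \<Rightarrow> 'a) \<Rightarrow> bool" where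
  "k_linear scale f \<longleftrightarrow> module_hom scale scale f"

definition k_bilinear :: "('k::comm_ring_1 \<Rightarrow> 'a::ab_group_add \<Rightarrow> 'a) \<Rightarrow> ('a \<Rightarrow> 'a \<Rightarrow> 'a) \<Rightarrow> bool" where
  "k_bilinear scale f \<longleftrightarrow>
     (\<forall>x. module_hom scale scale (\<lambda>y. f x y)) \<and> (\<forall>y. module_hom scale scale (\<lambda>x. f x y))"

locale hom_assoc_algebra = module scale
  for scale :: "'k::comm_ring_1 \<Rightarrow> 'a::ab_group_add \<Rightarrow> 'a" +
  fixes mu :: "'a \<Rightarrow> 'a \<Rightarrow> 'a" and \<alpha> :: "'a \<Rightarrow> 'a"
  assumes bilinear_mu: "k_bilinear scale mu"
    and linear_alpha: "k_linear scale \<alpha>"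
    and hom_assoc: "mu (\<alpha> x) (mu y z) = mu (mu x y) (\<alpha> z)"

locale assoc_algebra = module scale
  for scale :: "'k::comm_ring_1 \<Rightarrow> 'a::ab_group_add \<Rightarrow> 'a" +
  fixes \<nu> :: "'a \<Rightarrow> 'a \<Rightarrow> 'a"
  assumes bilinear_nu: "k_bilinear scale \<nu>"
    and assoc_nu: "\<nu> x (\<nu> y z) = \<nu> (\<nu> x y) z"

definition strongly_degenerate :: "('a \<Rightarrow> 'a \<Rightarrow> 'a) \<Rightarrow> bool" where
  "strongly_degenerate mu \<longleftrightarrow> (\<exists>a b. a \<noteq> b \<and> (\<forall>x. mu x a = mu x b \<and> mu a x = mu b x))"

definition untwist :: "('a \<Rightarrow> 'a \<Rightarrow> 'a) \<Rightarrow> ('a \<Rightarrow> 'a) \<Rightarrow> 'a \<Rightarrow> 'a \<Rightarrow> 'a" where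
  "untwist mu \<alpha> x y = inv \<alpha> (mu x y)"

text \<open>The \<open>k[[t]]\<close>-module \<open>A[[t]]\<close> is rendered by the type \<open>'a fps\<close>. A series of maps
  \<open>\<Sum>i. t^i f\<^sub>i\<close> is rendered by its sequence of coefficients \<open>f\<close>, and the following
  are the extensions of such series to \<open>A[[t]]\<close>.\<close>

definition ext_linear :: "(nat \<Rightarrow> 'a \<Rightarrow> 'a) \<Rightarrow> 'a::comm_monoid_add fps \<Rightarrow> 'a fps" where
  "ext_linear f x = Abs_fps (\<lambda>n. \<Sum>(i, j) \<in> {(i, j). i + j = n}. f i (x $ j))"

definition ext_bilinear :: "(nat \<Rightarrow> 'a \<Rightarrow> 'a \<Rightarrow> 'a) \<Rightarrow> 'a::comm_monoid_add fps \<Rightarrow> 'a fps \<Rightarrow> 'a fps" where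
  "ext_bilinear f x y =
     Abs_fps (\<lambda>n. \<Sum>(i, j, l) \<in> {(i, j, l). i + j + l = n}. f i (x $ j) (y $ l))"

text \<open>The index sets above are finite, so that the sums have their intended meaning.\<close>

lemma finite_pairs_sum: "finite {(i, j). i + j = (n::nat)}"
  by (rule finite_subset[of _ "{..n} \<times> {..n}"]) auto

lemma finite_triples_sum: "finite {(i, j, l). i + j + l = (n::nat)}"
  by (rule finite_subset[of _ "{..n} \<times> {..n} \<times> {..n}"]) auto

locale formal_deformation = hom_assoc_algebra scale mu \<alpha>
  for scale :: "'k::comm_ring_1 \<Rightarrow> 'a::ab_group_add \<Rightarrow> 'a" and mu \<alpha> +
  fixes mus :: "nat \<Rightarrow> 'a \<Rightarrow> 'a \<Rightarrow> 'a" and alphas :: "nat \<Rightarrow> 'a \<Rightarrow> 'a"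
  assumes mus_0: "mus 0 = mu"
    and alphas_0: "alphas 0 = \<alpha>"
    and bilinear_mus: "k_bilinear scale (mus i)"
    and linear_alphas: "k_linear scale (alphas i)"
    and hom_assoc_t:
      "ext_bilinear mus (ext_linear alphas x) (ext_bilinear mus y z) =
       ext_bilinear mus (ext_bilinear mus x y) (ext_linear alphas z)"

locale assoc_formal_deformation = assoc_algebra scale \<nu>
  for scale :: "'k::comm_ring_1 \<Rightarrow> 'a::ab_group_add \<Rightarrow> 'a" and \<nu> +
  fixes nus :: "nat \<Rightarrow> 'a \<Rightarrow> 'a \<Rightarrow> 'a"
  assumes nus_0: "nus 0 = \<nu>"
    and bilinear_nus: "k_bilinear scale (nus i)"
    and assoc_t:
      "ext_bilinear nus x (ext_bilinear nus y z) = ext_bilinear nus (ext_bilinear nus x y) z"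

definition formal_twisting ::
  "('k::comm_ring_1 \<Rightarrow> 'a::ab_group_add \<Rightarrow> 'a) \<Rightarrow> (nat \<Rightarrow> 'a \<Rightarrow> 'a \<Rightarrow> 'a) \<Rightarrow> (nat \<Rightarrow> 'a \<Rightarrow> 'a) \<Rightarrow> bool" where
  "formal_twisting scale nus alphas \<longleftrightarrow>
     (\<forall>i. k_linear scale (alphas i)) \<and>
     (\<forall>x y z.
        ext_linear alphas (ext_bilinear nus (ext_linear alphas x) (ext_linear alphas (ext_bilinear nus y z))) =
        ext_linear alphas (ext_bilinear nus (ext_linear alphas (ext_bilinear nus x y)) (ext_linear alphas z)))"

text \<open>Since \<^const>\<open>inv\<close> is total, \<^const>\<open>untwist\<close> is the intended operation only when
  \<open>\<alpha>\<close> is bijective. The lemmas \<open>bij_twist\<close> and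
  \<open>assoc_algebra_untwist\<close> show that it is, and that it is associative, for a surjective twisting
  map of an algebra which is not strongly degenerate.\<close>

lemma (in hom_assoc_algebra) bij_twist:
  assumes nd: "\<not> strongly_degenerate mu" and surj: "surj \<alpha>"
  shows "bij \<alpha>"
proof -
  have add_r: "mu x (y + z) = mu x y + mu x z" and add_l: "mu (x + y) z = mu x z + mu y z" for x y z
    using bilinear_mu by (simp_all add: k_bilinear_def module_hom.add module_hom_iff)
  have zero_r: "mu x 0 = 0" and zero_l: "mu 0 x = 0" for x
    using add_r[of x 0 0] add_l[of 0 0 x] by simp_all
  have add_a: "\<alpha> (x + y) = \<alpha> x + \<alpha> y" for x y
    using linear_alpha by (simp add: k_linear_def module_hom_iff)
  have nd0: "c = 0" if "\<And>x. mu x c = 0" "\<And>x. mu c x = 0" for c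
    using nd that unfolding strongly_degenerate_def by (metis zero_r zero_l)
  have preim: "\<exists>y. x = \<alpha> y" for x using surj by (meson surjD)
  have ker: "c = 0" if c: "\<alpha> c = 0" for c
  proof -
    have r1: "mu x (mu y c) = 0" for x y
      using preim[of x] hom_assoc[of _ y c] c zero_r by metis
    have l1: "mu (mu c y) z = 0" for y z
      using preim[of z] hom_assoc[of c y] c zero_l by metis
    have f: "mu z (mu c y) = 0" for y z
    proof (rule nd0)
      obtain z' where z': "z = \<alpha> z'" using preim by blast
      fix w
      obtain w' where w': "w = \<alpha> w'" using preim by blast
      have "mu z (mu c y) = mu (mu z' c) (\<alpha> y)" using z' hom_assoc by simp
      then show "mu w (mu z (mu c y)) = 0"
        using w' hom_assoc[of w' "mu z' c" "\<alpha> y"] r1 zero_l by simp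
      show "mu (mu z (mu c y)) w = 0"
        using w' hom_assoc[of z "mu c y" w'] l1 zero_r by simp
    qed
    have c_l: "mu c y = 0" for y by (rule nd0[OF f l1])
    have c_r: "mu y c = 0" for y
    proof (rule nd0)
      show "mu x (mu y c) = 0" for x by (rule r1)
      fix x
      obtain x' where "x = \<alpha> x'" using preim by blast
      then show "mu (mu y c) x = 0" using hom_assoc[of y c x'] f by simp
    qed
    show ?thesis by (rule nd0[OF c_r c_l])
  qed
  have "inj \<alpha>"
  proof (rule injI)
    fix x y assume "\<alpha> x = \<alpha> y"
    moreover have "\<alpha> x = \<alpha> (x - y) + \<alpha> y" using add_a[of "x - y" y] by simp
    ultimately show "x = y" using ker[of "x - y"] by simp
  qed
  with surj show ?thesis by (simp add: bij_def)
qed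

lemma twist_balanced:
  assumes h: "\<And>x y z. m (a x) (m y z) = m (m x y) (a z)"
    and ab: "\<And>x. a (b x) = x" and ba: "\<And>x. b (a x) = x"
    and nd: "\<And>c d. (\<And>x. m x c = m x d \<and> m c x = m d x) \<Longrightarrow> c = d"
  shows "m x (b (m y z)) = m (b (m x y)) z"
proof -
  define L R where "L = (\<lambda>u v w. m (b (m u v)) w)" and "R = (\<lambda>u v w. m u (b (m v w)))"
  have h': "m (m x y) z = m (a x) (m y (b z))" for x y z
    using h[of x y "b z"] by (simp add: ab)
  have h'': "m x (m y z) = m (m (b x) y) (a z)" for x y z
    using h[of "b x" y z] by (simp add: ab)
  have f4: "m t (m (L u v w) y) = m t (m (R u v w) y)" for t u v w y
  proof -
    let ?s = "m (b (b t)) u" and ?q = "m w (b y)"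
    have "m t (m (L u v w) y) = m t (m (m u v) ?q)"
      unfolding L_def by (subst h'[of "b (m u v)"]) (simp only: ab)
    also have "\<dots> = m (m (b t) (m u v)) (a ?q)"
      by (rule h'')
    also have "\<dots> = m (m ?s (a v)) (a ?q)"
      by (simp only: h''[of "b t" u v])
    also have "\<dots> = m (a ?s) (m (a v) ?q)"
      by (rule h[symmetric])
    also have "\<dots> = m (a ?s) (m (m v w) y)"
      by (simp only: h[of v w "b y"] ab)
    also have "\<dots> = m (m ?s (m v w)) (a y)"
      by (rule h)
    also have "\<dots> = m (m (b t) (R u v w)) (a y)"
      unfolding R_def by (simp only: h''[of "b t" u "b (m v w)"] ab)
    also have "\<dots> = m t (m (R u v w) y)"
      by (rule h''[symmetric])
    finally show ?thesis .
  qed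
  have f3: "m (m t (L u v w)) y = m (m t (R u v w)) y" for t u v w y
    using f4[of "a t" u v w "b y"] by (simp only: h'[of t _ y])
  have rl: "m (R u v w) (a z) = m (a u) (L v w z)" for u v w z
    unfolding R_def L_def by (simp only: h[symmetric] ab)
  have lr: "m (L u v w) (a z) = m (a u) (R v w z)" for u v w z
    unfolding R_def L_def using h[of "b (m u v)" w z] h[of u v "b (m w z)"] by (simp only: ab)
  have eq_l: "m (L u v w) (a z) = m (R u v w) (a z)" for u v w z
  proof (rule nd, intro conjI)
    fix t
    show "m t (m (L u v w) (a z)) = m t (m (R u v w) (a z))"
      by (rule f4)
    show "m (m (L u v w) (a z)) t = m (m (R u v w) (a z)) t"
      by (simp only: lr rl f3)
  qed
  have "L x y z = R x y z"
  proof (rule nd, intro conjI)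
    fix t
    show "m t (L x y z) = m t (R x y z)"
      using rl[of "b t" x y z] lr[of "b t" x y z] eq_l[of "b t" x y z] by (simp only: ab)
    show "m (L x y z) t = m (R x y z) t"
      using eq_l[of x y z "b t"] by (simp only: ab)
  qed
  then show ?thesis by (simp add: L_def R_def)
qed

lemma (in hom_assoc_algebra) assoc_algebra_untwist:
  assumes nd: "\<not> strongly_degenerate mu" and surj: "surj \<alpha>"
  shows "assoc_algebra scale (untwist mu \<alpha>)"
proof -
  have bij: "bij \<alpha>" using bij_twist assms by blast
  have a1: "\<alpha> (inv \<alpha> x) = x" for x using bij by (simp add: bij_is_surj surj_f_inv_f)
  have a2: "inv \<alpha> (\<alpha> x) = x" for x using bij by (simp add: bij_is_inj)
  have lin: "\<alpha> (x + y) = \<alpha> x + \<alpha> y" "\<alpha> (scale c x) = scale c (\<alpha> x)" for x y c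
    using linear_alpha by (simp_all add: k_linear_def module_hom_iff)
  have inv_add: "inv \<alpha> (x + y) = inv \<alpha> x + inv \<alpha> y" for x y by (metis a1 a2 lin(1))
  have inv_scale: "inv \<alpha> (scale c x) = scale c (inv \<alpha> x)" for c x by (metis a1 a2 lin(2))
  have bil: "k_bilinear scale (untwist mu \<alpha>)"
    using bilinear_mu by (simp add: k_bilinear_def module_hom_iff untwist_def inv_add inv_scale)
  have "mu x (inv \<alpha> (mu y z)) = mu (inv \<alpha> (mu x y)) z" for x y z
    by (rule twist_balanced[OF hom_assoc a1 a2]) (use nd in \<open>auto simp: strongly_degenerate_def\<close>)
  then show ?thesis
    using module_axioms bil by (simp add: assoc_algebra_def assoc_algebra_axioms_def untwist_def)
qed

end

theory Submission
  imports Defs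
begin

text \<open>
  The idea is to do over \<open>k[[t]]\<close> what \<open>bij_twist\<close> and \<open>assoc_algebra_untwist\<close> do over \<open>k\<close>: to
  untwist \<open>\<mu>\<^sub>t\<close> by the inverse of \<open>\<alpha>\<^sub>t\<close>, so that \<open>x \<star>\<^sub>t y = \<alpha>\<^sub>t\<^sup>-\<^sup>1(\<mu>\<^sub>t(x, y))\<close> is the only candidate.

  Everything needed for this is visible in degree zero. A series of maps is \<open>f\<^sub>0\<close> plus terms
  that raise the \<open>t\<close>-adic order, hence injectivity and surjectivity of \<open>\<alpha>\<^sub>0 = \<alpha>\<close> pass to \<open>\<alpha>\<^sub>t\<close>
  (\<open>bij_ext_linear\<close>), and a pair of distinct series witnessing strong degeneracy of \<open>\<mu>\<^sub>t\<close> would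
  yield one for \<open>\<mu>\<close>, namely their first pair of distinct coefficients
  (\<open>not_strongly_degenerate_ext_bilinear\<close>). The purely equational lemma \<open>twist_balanced\<close> then
  applies to \<open>\<mu>\<^sub>t\<close> and \<open>\<alpha>\<^sub>t\<close> on \<open>A[[t]]\<close>, and gives associativity of \<open>\<star>\<^sub>t\<close>.

  What remains is that \<open>\<star>\<^sub>t\<close> again comes from a series of bilinear maps \<open>\<nu>\<^sub>n\<close> on \<open>A\<close>. For fixed
  \<open>x\<close> and \<open>y\<close> in \<open>A\<close>, the series \<open>\<Sum>n. t^n \<nu>\<^sub>n(x, y)\<close> has to be the preimage under \<open>\<alpha>\<^sub>t\<close> of
  \<open>\<Sum>n. t^n \<mu>\<^sub>n(x, y)\<close>; taking this as the definition of \<open>\<nu>\<^sub>n\<close>, bilinearity is inherited from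
  \<open>\<mu>\<^sub>t\<close> because the inverse of \<open>\<alpha>\<^sub>t\<close> is linear, and \<open>ext_linear_ext_bilinear\<close> extends the
  identity from \<open>A\<close> to \<open>A[[t]]\<close>. The twisting identity for \<open>\<star>\<^sub>t\<close> is then hom-associativity of
  \<open>\<mu>\<^sub>t\<close> rewritten.
\<close>

section \<open>Series of maps and their leading terms\<close>

lemma ext_linear_nth: "ext_linear f x $ n = (\<Sum>j\<le>n. f (n - j) (x $ j))"
  unfolding ext_linear_def fps_nth_Abs_fps
  by (rule sum.reindex_bij_witness[where i = "\<lambda>j. (n - j, j)" and j = snd]) auto

text \<open>In degree \<open>n\<close>, only the term of index 0 of the series sees the coefficient of degree
  \<open>n\<close> of its argument; all others see coefficients of smaller degree.\<close>

lemma ext_linear_nth_top: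
  "ext_linear f x $ n = (\<Sum>j<n. f (n - j) (x $ j)) + f 0 (x $ n)"
  by (simp add: ext_linear_nth flip: lessThan_Suc_atMost)

lemma ext_linear_eq_leading:
  fixes f :: "nat \<Rightarrow> 'a::ab_group_add \<Rightarrow> 'a"
  assumes "ext_linear f x = ext_linear f y" and "\<And>j. j < n \<Longrightarrow> x $ j = y $ j"
  shows "f 0 (x $ n) = f 0 (y $ n)"
proof -
  have "(\<Sum>j<n. f (n - j) (x $ j)) = (\<Sum>j<n. f (n - j) (y $ j))"
    using assms(2) by simp
  then show ?thesis
    using arg_cong[OF assms(1), of "\<lambda>s. s $ n"] by (simp add: ext_linear_nth_top)
qed

lemma fps_neq_first_difference:
  assumes "x \<noteq> y"
  obtains n where "x $ n \<noteq> y $ n" and "\<And>j. j < n \<Longrightarrow> x $ j = y $ j"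
proof
  obtain m where m: "x $ m \<noteq> y $ m" using assms by (auto simp: fps_eq_iff)
  show "x $ (LEAST n. x $ n \<noteq> y $ n) \<noteq> y $ (LEAST n. x $ n \<noteq> y $ n)"
    by (rule LeastI[of "\<lambda>n. x $ n \<noteq> y $ n", OF m])
  show "x $ j = y $ j" if "j < (LEAST n. x $ n \<noteq> y $ n)" for j
    using not_less_Least[OF that] by simp
qed

section \<open>Inverting a series of maps with bijective leading term\<close>

text \<open>The coefficients of a preimage of \<open>y\<close> under \<open>ext_linear f\<close>: read in each degree \<open>n\<close>,
  the equation \<open>ext_linear f x = y\<close> can be solved for the top coefficient \<open>x $ n\<close>.\<close>

fun preimage_coeff :: "(nat \<Rightarrow> 'a \<Rightarrow> 'a) \<Rightarrow> 'a::ab_group_add fps \<Rightarrow> nat \<Rightarrow> 'a" where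
  "preimage_coeff f y n = inv (f 0) (y $ n - (\<Sum>j<n. f (n - j) (preimage_coeff f y j)))"

declare preimage_coeff.simps [simp del]

lemma bij_ext_linear:
  fixes f :: "nat \<Rightarrow> 'a::ab_group_add \<Rightarrow> 'a"
  assumes "bij (f 0)"
  shows "bij (ext_linear f)"
proof (rule bijI)
  show "inj (ext_linear f)"
  proof (rule injI, rule ccontr)
    fix x y assume eq: "ext_linear f x = ext_linear f y" and "x \<noteq> y"
    then obtain n where "x $ n \<noteq> y $ n" and "\<And>j. j < n \<Longrightarrow> x $ j = y $ j"
      using fps_neq_first_difference by blast
    with ext_linear_eq_leading[OF eq] show False
      using bij_is_inj[OF assms] by (simp add: inj_eq)
  qed
  have "ext_linear f (Abs_fps (preimage_coeff f y)) = y" for y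
  proof (rule fps_ext)
    fix n
    have "f 0 (preimage_coeff f y n) = y $ n - (\<Sum>j<n. f (n - j) (preimage_coeff f y j))"
      by (subst preimage_coeff.simps) (rule surj_f_inv_f[OF bij_is_surj[OF assms]])
    then show "ext_linear f (Abs_fps (preimage_coeff f y)) $ n = y $ n"
      by (simp add: ext_linear_nth_top)
  qed
  then show "surj (ext_linear f)" by (rule surjI)
qed

section \<open>Non-degeneracy of a series of bilinear maps\<close>

text \<open>Multiplication by a constant series is a series of maps in one variable, which makes the
  leading term argument available for products.\<close>

lemma ext_bilinear_const_left:
  assumes zero: "\<And>i y. g i 0 y = 0"
  shows "ext_bilinear g (fps_const x) y = ext_linear (\<lambda>i. g i x) y"
proof (rule fps_ext)
  fix n
  have "(\<Sum>(i, j, l) \<in> {(i, j, l). i + j + l = n}. g i (fps_const x $ j) (y $ l)) =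
      (\<Sum>(i, j, l) \<in> {(i, j, l). i + j + l = n \<and> j = 0}. g i (fps_const x $ j) (y $ l))"
    by (rule sum.mono_neutral_right[OF finite_triples_sum]) (auto simp: zero split: if_splits)
  also have "\<dots> = (\<Sum>(i, l) \<in> {(i, l). i + l = n}. g i x (y $ l))"
    by (rule sum.reindex_bij_witness[where i = "\<lambda>(i, l). (i, 0, l)" and j = "\<lambda>(i, j, l). (i, l)"])
      auto
  finally show "ext_bilinear g (fps_const x) y $ n = ext_linear (\<lambda>i. g i x) y $ n"
    by (simp add: ext_bilinear_def ext_linear_def)
qed

lemma ext_bilinear_flip: "ext_bilinear g x y = ext_bilinear (\<lambda>i u v. g i v u) y x"
  unfolding ext_bilinear_def
  by (intro arg_cong[where f = Abs_fps] ext,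
      rule sum.reindex_bij_witness[where i = "\<lambda>(i, j, l). (i, l, j)" and j = "\<lambda>(i, j, l). (i, l, j)"])
    auto

lemma ext_bilinear_const_right:
  assumes "\<And>i x. g i x 0 = 0"
  shows "ext_bilinear g x (fps_const y) = ext_linear (\<lambda>i u. g i u y) x"
  by (subst ext_bilinear_flip) (rule ext_bilinear_const_left, rule assms)

text \<open>Two distinct series with the same products would, tested against constant series only,
  already have first distinct coefficients with the same products under \<open>g 0\<close>.\<close>

lemma not_strongly_degenerate_ext_bilinear:
  fixes g :: "nat \<Rightarrow> 'a::ab_group_add \<Rightarrow> 'a \<Rightarrow> 'a"
  assumes zero: "\<And>i y. g i 0 y = 0" "\<And>i x. g i x 0 = 0"
    and nd: "\<not> strongly_degenerate (g 0)"
  shows "\<not> strongly_degenerate (ext_bilinear g)"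
proof
  assume "strongly_degenerate (ext_bilinear g)"
  then obtain c d where "c \<noteq> d"
    and l: "\<And>x. ext_bilinear g x c = ext_bilinear g x d"
    and r: "\<And>x. ext_bilinear g c x = ext_bilinear g d x"
    unfolding strongly_degenerate_def by blast
  then obtain n where n: "c $ n \<noteq> d $ n" "\<And>j. j < n \<Longrightarrow> c $ j = d $ j"
    using fps_neq_first_difference by blast
  have "g 0 x (c $ n) = g 0 x (d $ n)" for x
    using ext_linear_eq_leading[of "\<lambda>i. g i x" c d n] l[of "fps_const x"] n(2)
    by (simp add: ext_bilinear_const_left zero)
  moreover have "g 0 (c $ n) x = g 0 (d $ n) x" for x
    using ext_linear_eq_leading[of "\<lambda>i u. g i u x" c d n] r[of "fps_const x"] n(2)
    by (simp add: ext_bilinear_const_right zero)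
  ultimately show False
    using nd n(1) unfolding strongly_degenerate_def by blast
qed

section \<open>Composing series of maps\<close>

text \<open>A composite of series of maps is determined by its effect on elements of \<open>A\<close>: if the
  identity \<open>f \<circ> g = h\<close> of series holds there, it holds on \<open>A[[t]]\<close>, because both sides of the
  conclusion expand to the sum of \<open>f p (g i (x $ j) (y $ l))\<close> over \<open>p + i + j + l = n\<close>.\<close>

lemma ext_linear_ext_bilinear:
  fixes f :: "nat \<Rightarrow> 'a::ab_group_add \<Rightarrow> 'a"
  assumes add: "\<And>i x y. f i (x + y) = f i x + f i y"
    and h: "\<And>x y. ext_linear f (Abs_fps (\<lambda>i. g i x y)) = Abs_fps (\<lambda>i. h i x y)"
  shows "ext_linear f (ext_bilinear g x y) = ext_bilinear h x y"
proof (rule fps_ext)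
  fix n
  have zero: "f i 0 = 0" for i using add[of i 0 0] by simp
  have sum: "f i (sum u S) = (\<Sum>s\<in>S. f i (u s))" for i S and u :: "nat \<times> nat \<times> nat \<Rightarrow> 'a"
    by (induction S rule: infinite_finite_induct) (simp_all add: zero add)
  let ?P = "\<lambda>r. {(p, q). p + q = (r::nat)}" and ?T = "\<lambda>r. {(i, j, l). i + j + l = (r::nat)}"
  let ?F = "\<lambda>p i j l. f p (g i (x $ j) (y $ l))"
  have h': "h r u v = (\<Sum>(p, i) \<in> ?P r. f p (g i u v))" for r u v
    using arg_cong[OF h[of u v], of "\<lambda>s. s $ r"] by (simp add: ext_linear_def)
  have "ext_linear f (ext_bilinear g x y) $ n = (\<Sum>a \<in> ?P n. \<Sum>b \<in> ?T (snd a).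
      ?F (fst a) (fst b) (fst (snd b)) (snd (snd b)))"
    by (simp add: ext_linear_def ext_bilinear_def sum case_prod_beta)
  also have "\<dots> = (\<Sum>(a, b) \<in> (SIGMA a:?P n. ?T (snd a)).
      ?F (fst a) (fst b) (fst (snd b)) (snd (snd b)))"
    by (rule sum.Sigma) (use finite_pairs_sum finite_triples_sum in auto)
  also have "\<dots> = (\<Sum>(b, a) \<in> (SIGMA b:?T n. ?P (fst b)).
      ?F (fst a) (snd a) (fst (snd b)) (snd (snd b)))"
    by (rule sum.reindex_bij_witness[where
          i = "\<lambda>((r, j, l), (p, i)). ((p, i + j + l), (i, j, l))" and
          j = "\<lambda>((p, q), (i, j, l)). ((p + i, j, l), (p, i))"]) auto
  also have "\<dots> = (\<Sum>b \<in> ?T n. \<Sum>a \<in> ?P (fst b).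
      ?F (fst a) (snd a) (fst (snd b)) (snd (snd b)))"
    by (rule sum.Sigma[symmetric]) (use finite_pairs_sum finite_triples_sum in auto)
  also have "\<dots> = ext_bilinear h x y $ n"
    by (simp add: ext_bilinear_def h' case_prod_beta)
  finally show "ext_linear f (ext_bilinear g x y) $ n = ext_bilinear h x y $ n" .
qed

section \<open>Untwisting a formal deformation\<close>

theorem proposition3:
  fixes scale :: "'k::comm_ring_1 \<Rightarrow> 'a::ab_group_add \<Rightarrow> 'a"
    and mu :: "'a \<Rightarrow> 'a \<Rightarrow> 'a" and \<alpha> :: "'a \<Rightarrow> 'a"
    and mus :: "nat \<Rightarrow> 'a \<Rightarrow> 'a \<Rightarrow> 'a" and alphas :: "nat \<Rightarrow> 'a \<Rightarrow> 'a"
  assumes "hom_assoc_algebra scale mu \<alpha>"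
    and "\<not> strongly_degenerate mu"
    and "surj \<alpha>"
    and "formal_deformation scale mu \<alpha> mus alphas"
  shows "\<exists>nus. assoc_formal_deformation scale (untwist mu \<alpha>) nus \<and>
           formal_twisting scale nus alphas \<and> alphas 0 = \<alpha> \<and>
           (\<forall>x y. ext_bilinear mus x y = ext_linear alphas (ext_bilinear nus x y))"
proof -
  interpret formal_deformation scale mu \<alpha> mus alphas by (rule assms(4))
  have bij0: "bij (alphas 0)" using bij_twist[OF assms(2,3)] by (simp add: alphas_0)
  have alphas_add: "alphas i (x + y) = alphas i x + alphas i y"
    and alphas_scale: "alphas i (scale c x) = scale c (alphas i x)" for i c x y
    using linear_alphas[of i] by (simp_all add: k_linear_def module_hom_iff)
  have mus_add: "mus i (x + y) z = mus i x z + mus i y z" "mus i z (x + y) = mus i z x + mus i z y"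
    and mus_scale: "mus i (scale c x) z = scale c (mus i x z)"
      "mus i z (scale c x) = scale c (mus i z x)" for i c x y z
    using bilinear_mus[of i] by (simp_all add: k_bilinear_def module_hom_iff)
  have mus_zero: "mus i 0 x = 0" "mus i x 0 = 0" for i x
    using mus_add(1)[of i 0 0 x] mus_add(2)[of i x 0 0] by simp_all

  define B where "B = inv (ext_linear alphas)"
  have bij_t: "bij (ext_linear alphas)" by (rule bij_ext_linear, rule bij0)
  have AB: "ext_linear alphas (B x) = x" for x
    using bij_t by (simp add: B_def bij_is_surj surj_f_inv_f)
  have BA: "B (ext_linear alphas x) = x" for x
    using bij_t by (simp add: B_def bij_is_inj)

  \<comment> \<open>Only scalars from \<open>k\<close> are needed, and \<open>'a fps\<close> carries no scaling by them, so the
    coefficientwise action is spelled out.\<close>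
  have A_add: "ext_linear alphas (x + y) = ext_linear alphas x + ext_linear alphas y" for x y
    by (rule fps_ext) (simp add: ext_linear_nth alphas_add sum.distrib)
  have A_scale: "ext_linear alphas (Abs_fps (\<lambda>n. scale c (x $ n))) =
      Abs_fps (\<lambda>n. scale c (ext_linear alphas x $ n))" for c x
    by (rule fps_ext) (simp add: ext_linear_nth alphas_scale scale_sum_right)
  have B_add: "B (x + y) = B x + B y" for x y
    using BA[of "B x + B y"] by (simp add: A_add AB)
  have B_scale: "B (Abs_fps (\<lambda>n. scale c (x $ n))) = Abs_fps (\<lambda>n. scale c (B x $ n))" for c x
    using BA[of "Abs_fps (\<lambda>n. scale c (B x $ n))"] by (simp add: A_scale AB)

  define nus where "nus n x y = B (Abs_fps (\<lambda>i. mus i x y)) $ n" for n x y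
  have star: "ext_linear alphas (ext_bilinear nus x y) = ext_bilinear mus x y" for x y
    by (rule ext_linear_ext_bilinear) (simp_all add: alphas_add nus_def AB fps_nth_inverse)
  have star': "ext_bilinear nus x y = B (ext_bilinear mus x y)" for x y
    using star[of x y] BA by metis

  have nus_add: "nus i (x + y) z = nus i x z + nus i y z" "nus i z (x + y) = nus i z x + nus i z y"
    for i x y z
    using B_add[of "Abs_fps (\<lambda>i. mus i x z)" "Abs_fps (\<lambda>i. mus i y z)"]
      B_add[of "Abs_fps (\<lambda>i. mus i z x)" "Abs_fps (\<lambda>i. mus i z y)"]
    by (simp_all add: nus_def mus_add fps_plus_def)
  have nus_scale: "nus i (scale c x) z = scale c (nus i x z)"
      "nus i z (scale c x) = scale c (nus i z x)" for i c x z
    using B_scale[of c "Abs_fps (\<lambda>i. mus i x z)"] B_scale[of c "Abs_fps (\<lambda>i. mus i z x)"]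
    by (simp_all add: nus_def mus_scale)
  have nus_bilinear: "k_bilinear scale (nus i)" for i
    using module_axioms by (simp add: k_bilinear_def module_hom_iff nus_add nus_scale)

  have nus_0: "nus 0 = untwist mu \<alpha>"
  proof (intro ext)
    fix x y
    have "alphas 0 (nus 0 x y) = ext_linear alphas (B (Abs_fps (\<lambda>i. mus i x y))) $ 0"
      by (simp add: ext_linear_nth nus_def)
    also have "\<dots> = mu x y" by (simp add: AB mus_0)
    finally show "nus 0 x y = untwist mu \<alpha> x y"
      using bij0 unfolding untwist_def by (metis alphas_0 bij_is_inj inv_f_f)
  qed

  have "\<not> strongly_degenerate (ext_bilinear mus)"
    using assms(2) by (intro not_strongly_degenerate_ext_bilinear) (simp_all add: mus_zero mus_0)
  then have "ext_bilinear mus x (B (ext_bilinear mus y z)) =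
      ext_bilinear mus (B (ext_bilinear mus x y)) z" for x y z
    by (intro twist_balanced[OF hom_assoc_t AB BA]) (auto simp: strongly_degenerate_def)
  then have "ext_bilinear nus x (ext_bilinear nus y z) =
      ext_bilinear nus (ext_bilinear nus x y) z" for x y z
    by (simp add: star')
  then have "assoc_formal_deformation scale (untwist mu \<alpha>) nus"
    using assoc_algebra_untwist[OF assms(2,3)] nus_0 nus_bilinear
    by (simp add: assoc_formal_deformation_def assoc_formal_deformation_axioms_def)
  moreover have "formal_twisting scale nus alphas"
    by (simp add: formal_twisting_def linear_alphas star hom_assoc_t)
  ultimately show ?thesis using alphas_0 star by metis
qed

end
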